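(* Let $\mathcal{U}'\subset\mathcal{U}$ be any set with the quadrant extension property (QEP) with respect to $\mathcal{U}$. Let $h_1,\dots,h_M$ each be a control barrier function (CBF) for $(\mathcal{S},\mathcal{U}')$, with associated class-$\mathcal{K}$ functions $\alpha_1,\dots,\alpha_M$. If $\{h_k\}_{k=1}^M$ are non-interfering on $\mathcal{S}$, then the set $$\boldsymbol\mu_{\mathrm{all}}(q,v)=\bigcap_{k=1}^M\boldsymbol\mu_k(q,v,\mathcal{U})=\bigcap_{k=1}^M\{u\in\mathcal{U}\mid \dot h_k(q,v,u)\le\alpha_k(-h_k(q,v))\}$$ is nonempty for all $(q,v)\in\mathcal{S}\cap\left(\bigcap_{k=1}^M\mathcal{H}_k\right)$.
   Context: **System.** The state is $x=(q,v)\in\mathbb{R}^{n_1+n_2}$, with $q\in\mathbb{R}^{n_1}$, $v\in\mathbb{R}^{n_2}$, and dynamics $\dot q=g_1(q)v$, $\dot v=f(q,v)+g_2(q)u$, where $f:\mathbb{R}^{n_1}\times\mathbb{R}^{n_2}\to\mathbb{R}^{n_2}$, $g_1:\mathbb{R}^{n_1}\to\mathbb{R}^{n_1\times n_2}$, $g_2:\mathbb{R}^{n_1}\to\mathbb{R}^{n_2\times m}$ are of class $C^2$. The control $u$ takes values in $\mathcal{U}\subset\mathbb{R}^m$, which is compact, convex and contains $0$. **Safe set.** Given $\kappa_i:\mathbb{R}^{n_1}\to\mathbb{R}$ of class $C^2$ ($i=1,\dots,N_1$) and $\eta_j:\mathbb{R}^{n_2}\to\mathbb{R}$ of class $C^1$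 ($j=1,\dots,N_2$), the safe set is $\mathcal{S}=\left(\bigcap_{i}\{q\mid\kappa_i(q)\le0\}\right)\times\left(\bigcap_{j}\{v\mid\eta_j(v)\le0\}\right)$. **Notation.** $\nabla_q$ and $\nabla_v$ denote gradients (row vectors) in $q$ and $v$. For $C^1$ functions $h:\mathbb{R}^{n_1+n_2}\to\mathbb{R}$, $\dot h(q,v,u)=\nabla_q h(q,v)g_1(q)v+\nabla_v h(q,v)\,(f(q,v)+g_2(q)u)$ is the derivative along the dynamics. A class-$\mathcal{K}$ function is a continuous strictly increasing function on $[0,\infty)$ vanishing at $0$. **CBF.** Let $\mathcal{X}\subseteq\mathcal{S}$, $\mathcal{Y}\subseteq\mathcal{U}$. A $C^1$ function $h$ is a *control barrier function (CBF) for $(\mathcal{X},\mathcal{Y})$* if there is a class-$\mathcal{K}$ function $\alpha$ such that $\boldsymbol\mu(q,v,\mathcal{Y})=\{u\in\mathcal{Y}\mid\dot h(q,v,u)\le\alpha(-h(q,v))\}$ is nonempty for all $(q,v)\in\mathcal{H}\cap\mathcal{X}$, where $\mathcal{H}=\{(q,v)\mid h(q,v)\le0\}$. For $h_k$, the corresponding objects are written $\alpha_k,\boldsymbol\mu_k,\mathcal{H}_k$; each $\alpha_k$ is a fixed function witnessing the CBF property. **Non-interfering.** $\{h_k\}_{k=1}^M$ are *non-interfering on $\mathcal{X}$* if for every pair $i,j$, $(\nabla_v h_i(q,v)g_2(q))\cdot(\nabla_v h_j(q,v)g_2(q))\ge0$ for all $(q,v)\in\mathcal{X}$. **QEP.**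 $\mathcal{U}'\subset\mathcal{U}$ has the *quadrant extension property with respect to $\mathcal{U}$* if for every family of $m$ mutually orthogonal (affine) hyperplanes $\mathcal{P}_1,\dots,\mathcal{P}_m$ in $\mathbb{R}^m$ with $\mathcal{P}_i\cap\mathcal{U}'\ne\emptyset$ for all $i\in\{1,\dots,m\}$, the unique point $p$ common to all $m$ hyperplanes belongs to $\mathcal{U}$. *)

theory Defs
  imports "HOL-Analysis.Analysis"
begin

text \<open>The state space is the product \<open>(real ^ 'n1) \<times> (real ^ 'n2)\<close>; a state is a pair \<open>(q, v)\<close>.\<close>

definition C1 :: "('a::real_normed_vector \<Rightarrow> 'b::real_normed_vector) \<Rightarrow> bool" where
  "C1 F \<longleftrightarrow> (\<exists>F' :: 'a \<Rightarrow> 'a \<Rightarrow>\<^sub>L 'b.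
     (\<forall>x. (F has_derivative blinfun_apply (F' x)) (at x)) \<and> continuous_on UNIV F')"

definition C2 :: "('a::real_normed_vector \<Rightarrow> 'b::real_normed_vector) \<Rightarrow> bool" where
  "C2 F \<longleftrightarrow> (\<exists>F' :: 'a \<Rightarrow> 'a \<Rightarrow>\<^sub>L 'b.
     (\<forall>x. (F has_derivative blinfun_apply (F' x)) (at x)) \<and> C1 F')"

definition gradient :: "('a::euclidean_space \<Rightarrow> real) \<Rightarrow> 'a \<Rightarrow> 'a" where
  "gradient F x = (THE D. GDERIV F x :> D)"

lemma gradient_GDERIV:
  assumes "F differentiable (at x)"
  shows "GDERIV F x :> gradient F x"
proof -
  obtain F' where F': "(F has_derivative F') (at x)"
    using assms by (auto simp: differentiable_def)
  then interpret linear F'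
    by (rule has_derivative_linear)
  let ?D = "\<Sum>b\<in>Basis. F' b *\<^sub>R b"
  have "F' y = y \<bullet> ?D" for y
  proof -
    have "F' y = F' (\<Sum>b\<in>Basis. (y \<bullet> b) *\<^sub>R b)"
      by (simp add: euclidean_representation)
    also have "\<dots> = y \<bullet> ?D"
      by (simp add: sum scale inner_sum_right mult.commute)
    finally show ?thesis .
  qed
  then have F'_eq: "F' = (\<lambda>y. y \<bullet> ?D)"
    by (rule ext)
  have "GDERIV F x :> ?D"
    unfolding gderiv_def by (rule has_derivative_eq_rhs[OF F' F'_eq])
  moreover have "D = D'" if "GDERIV F x :> D" "GDERIV F x :> D'" for D D'
  proof -
    have "(\<lambda>y. y \<bullet> D) = (\<lambda>y. y \<bullet> D')"
      using that unfolding gderiv_def by (rule has_derivative_unique)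
    then have "\<forall>y. y \<bullet> D = y \<bullet> D'"
      by (rule fun_cong[THEN allI])
    then show ?thesis
      by (simp only: vector_eq_ldot)
  qed
  ultimately have "\<exists>!D. GDERIV F x :> D"
    by blast
  then show ?thesis
    unfolding gradient_def by (rule theI')
qed

definition grad_q :: "((real ^ 'n1) \<times> (real ^ 'n2) \<Rightarrow> real) \<Rightarrow> real ^ 'n1 \<Rightarrow> real ^ 'n2 \<Rightarrow> real ^ 'n1" where
  "grad_q h q v = gradient (\<lambda>q'. h (q', v)) q"

definition grad_v :: "((real ^ 'n1) \<times> (real ^ 'n2) \<Rightarrow> real) \<Rightarrow> real ^ 'n1 \<Rightarrow> real ^ 'n2 \<Rightarrow> real ^ 'n2" where
  "grad_v h q v = gradient (\<lambda>v'. h (q, v')) v"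

definition hdot ::
  "((real ^ 'n1) \<times> (real ^ 'n2) \<Rightarrow> real ^ 'n2) \<Rightarrow> (real ^ 'n1 \<Rightarrow> real ^ 'n2 ^ 'n1)
   \<Rightarrow> (real ^ 'n1 \<Rightarrow> real ^ 'm ^ 'n2) \<Rightarrow> ((real ^ 'n1) \<times> (real ^ 'n2) \<Rightarrow> real)
   \<Rightarrow> real ^ 'n1 \<Rightarrow> real ^ 'n2 \<Rightarrow> real ^ 'm \<Rightarrow> real" where
  "hdot f g1 g2 h q v u =
     grad_q h q v \<bullet> (g1 q *v v) + grad_v h q v \<bullet> (f (q, v) + g2 q *v u)"

definition safe_set ::
  "nat \<Rightarrow> (nat \<Rightarrow> real ^ 'n1 \<Rightarrow> real) \<Rightarrow> nat \<Rightarrow> (nat \<Rightarrow> real ^ 'n2 \<Rightarrow> real)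
   \<Rightarrow> ((real ^ 'n1) \<times> (real ^ 'n2)) set" where
  "safe_set N1 \<kappa> N2 \<eta> = (\<Inter>i\<in>{1..N1}. {q. \<kappa> i q \<le> 0}) \<times> (\<Inter>j\<in>{1..N2}. {v. \<eta> j v \<le> 0})"

definition sublevel :: "('a \<Rightarrow> real) \<Rightarrow> 'a set" where
  "sublevel h = {x. h x \<le> 0}"

text \<open>Only the values on \<open>{0..}\<close> of a class-K function are relevant.\<close>

definition class_K :: "(real \<Rightarrow> real) \<Rightarrow> bool" where
  "class_K \<alpha> \<longleftrightarrow> continuous_on {0..} \<alpha> \<and> strict_mono_on {0..} \<alpha> \<and> \<alpha> 0 = 0"

definition mu ::
  "((real ^ 'n1) \<times> (real ^ 'n2) \<Rightarrow> real ^ 'n2) \<Rightarrow> (real ^ 'n1 \<Rightarrow> real ^ 'n2 ^ 'n1)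
   \<Rightarrow> (real ^ 'n1 \<Rightarrow> real ^ 'm ^ 'n2) \<Rightarrow> ((real ^ 'n1) \<times> (real ^ 'n2) \<Rightarrow> real) \<Rightarrow> (real \<Rightarrow> real)
   \<Rightarrow> real ^ 'n1 \<Rightarrow> real ^ 'n2 \<Rightarrow> (real ^ 'm) set \<Rightarrow> (real ^ 'm) set" where
  "mu f g1 g2 h \<alpha> q v Y = {u \<in> Y. hdot f g1 g2 h q v u \<le> \<alpha> (- h (q, v))}"

text \<open>\<open>cbf_witness\<close> says that \<open>\<alpha>\<close> witnesses the CBF property of \<open>h\<close> for \<open>(X, Y)\<close>.\<close>

definition cbf_witness ::
  "((real ^ 'n1) \<times> (real ^ 'n2) \<Rightarrow> real ^ 'n2) \<Rightarrow> (real ^ 'n1 \<Rightarrow> real ^ 'n2 ^ 'n1)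
   \<Rightarrow> (real ^ 'n1 \<Rightarrow> real ^ 'm ^ 'n2) \<Rightarrow> ((real ^ 'n1) \<times> (real ^ 'n2)) set \<Rightarrow> (real ^ 'm) set
   \<Rightarrow> ((real ^ 'n1) \<times> (real ^ 'n2) \<Rightarrow> real) \<Rightarrow> (real \<Rightarrow> real) \<Rightarrow> bool" where
  "cbf_witness f g1 g2 X Y h \<alpha> \<longleftrightarrow>
     class_K \<alpha> \<and> (\<forall>q v. (q, v) \<in> sublevel h \<inter> X \<longrightarrow> mu f g1 g2 h \<alpha> q v Y \<noteq> {})"

definition control_barrier_function ::
  "((real ^ 'n1) \<times> (real ^ 'n2) \<Rightarrow> real ^ 'n2) \<Rightarrow> (real ^ 'n1 \<Rightarrow> real ^ 'n2 ^ 'n1)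
   \<Rightarrow> (real ^ 'n1 \<Rightarrow> real ^ 'm ^ 'n2) \<Rightarrow> ((real ^ 'n1) \<times> (real ^ 'n2)) set \<Rightarrow> (real ^ 'm) set
   \<Rightarrow> ((real ^ 'n1) \<times> (real ^ 'n2) \<Rightarrow> real) \<Rightarrow> bool" where
  "control_barrier_function f g1 g2 X Y h \<longleftrightarrow> C1 h \<and> (\<exists>\<alpha>. cbf_witness f g1 g2 X Y h \<alpha>)"

definition non_interfering ::
  "(real ^ 'n1 \<Rightarrow> real ^ 'm ^ 'n2) \<Rightarrow> ((real ^ 'n1) \<times> (real ^ 'n2)) set \<Rightarrow> nat
   \<Rightarrow> (nat \<Rightarrow> (real ^ 'n1) \<times> (real ^ 'n2) \<Rightarrow> real) \<Rightarrow> bool" where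
  "non_interfering g2 X M h \<longleftrightarrow>
     (\<forall>i\<in>{1..M}. \<forall>j\<in>{1..M}. \<forall>q v. (q, v) \<in> X \<longrightarrow>
        (grad_v (h i) q v v* g2 q) \<bullet> (grad_v (h j) q v v* g2 q) \<ge> 0)"

text \<open>Families of \<open>m\<close> hyperplanes of \<open>real ^ 'm\<close> are indexed by the type \<open>'m\<close> itself,
  which has exactly \<open>m\<close> elements.\<close>

definition orthogonal_hyperplanes :: "('m \<Rightarrow> (real ^ 'm) set) \<Rightarrow> bool" where
  "orthogonal_hyperplanes P \<longleftrightarrow> (\<exists>a c.
     (\<forall>i. a i \<noteq> 0 \<and> P i = {x. a i \<bullet> x = c i}) \<and> (\<forall>i j. i \<noteq> j \<longrightarrow> orthogonal (a i) (a j)))"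

lemma orthogonal_hyperplanes_common_point:
  fixes P :: "'m::finite \<Rightarrow> (real ^ 'm) set"
  assumes "orthogonal_hyperplanes P"
  shows "\<exists>!p. \<forall>i. p \<in> P i"
proof -
  obtain a c where ac: "\<forall>i. a i \<noteq> 0 \<and> P i = {x. a i \<bullet> x = c i}"
      "\<forall>i j. i \<noteq> j \<longrightarrow> orthogonal (a i) (a j)"
    using assms unfolding orthogonal_hyperplanes_def by (elim exE conjE)
  have a: "a i \<noteq> 0" and P: "x \<in> P i \<longleftrightarrow> a i \<bullet> x = c i" for i x
    using ac(1) by simp_all
  have orth: "a i \<bullet> a j = 0" if "i \<noteq> j" for i j
    using ac(2) that by (simp add: orthogonal_def)
  define p where "p = (\<Sum>j\<in>UNIV. (c j / (a j \<bullet> a j)) *\<^sub>R a j)"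
  have p: "a i \<bullet> p = c i" for i
  proof -
    have "a i \<bullet> p = (\<Sum>j\<in>UNIV. (c j / (a j \<bullet> a j)) * (a i \<bullet> a j))"
      by (simp add: p_def inner_sum_right)
    also have "\<dots> = (\<Sum>j\<in>UNIV. if j = i then c i else 0)"
      by (rule sum.cong) (simp_all add: a orth)
    finally show ?thesis by simp
  qed
  have inj: "inj a"
  proof (rule injI, rule ccontr)
    fix i j assume "a i = a j" "i \<noteq> j"
    then have "a i \<bullet> a i = 0"
      using orth[of i j] by simp
    then show False
      using a by simp
  qed
  have "pairwise orthogonal (range a)"
    unfolding pairwise_image using ac(2) by (simp add: pairwise_def)
  then have "independent (range a)"
    by (rule pairwise_orthogonal_independent) (metis a rangeE)
  then have "dim (range a) = DIM(real ^ 'm)"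
    using inj by (simp add: dim_eq_card_independent card_image)
  then have span: "span (range a) = UNIV"
    by (simp only: dim_eq_full)
  show ?thesis
  proof (rule ex1I[of _ p])
    show "\<forall>i. p \<in> P i"
      using p P by simp
    fix p' assume "\<forall>i. p' \<in> P i"
    then have p': "a i \<bullet> p' = c i" for i
      using P by simp
    have "orthogonal (p' - p) y" if "y \<in> range a" for y
    proof -
      obtain i where y: "y = a i"
        using \<open>y \<in> range a\<close> by (rule rangeE)
      have "a i \<bullet> (p' - p) = 0"
        by (simp only: inner_diff_right p p' diff_self)
      then show ?thesis
        unfolding y orthogonal_def by (subst inner_commute)
    qed
    then have "orthogonal (p' - p) (p' - p)"
      using orthogonal_to_span[of "p' - p" "range a" "p' - p"] span by simp
    then show "p' = p"
      by (simp add: orthogonal_def)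
  qed
qed

definition quadrant_extension_property :: "(real ^ 'm) set \<Rightarrow> (real ^ 'm) set \<Rightarrow> bool" where
  "quadrant_extension_property U' U \<longleftrightarrow>
     (\<forall>P :: 'm \<Rightarrow> (real ^ 'm) set. orthogonal_hyperplanes P \<and> (\<forall>i. P i \<inter> U' \<noteq> {})
        \<longrightarrow> (THE p. \<forall>i. p \<in> P i) \<in> U)"

end

theory Submission
  imports Defs
begin

text \<open>At a fixed state the constraints are half-spaces \<open>w k \<bullet> u \<le> b k\<close> with \<open>w i \<bullet> w j \<ge> 0\<close>, each of
  which contains a point \<open>u k\<close> of \<open>U'\<close>. If no point of \<open>U\<close> satisfies all of them, a theorem of the
  alternative gives weights \<open>l k \<ge> 0\<close> such that the vectors \<open>x k = l k *\<^sub>R w k\<close> satisfy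
  \<open>(\<Sum>k. x k) \<bullet> p > (\<Sum>k. x k \<bullet> u k)\<close> for all \<open>p\<close> in \<open>U\<close>. On the other hand, the \<open>x k\<close> can be
  deformed into pairwise orthogonal vectors \<open>y k\<close> with the same sum such that \<open>\<Sum>k. y k \<bullet> u k\<close> is no
  larger than \<open>\<Sum>k. x k \<bullet> u k\<close>. The hyperplanes orthogonal to \<open>y k\<close> through \<open>u k\<close> then meet in a
  point \<open>p\<close>, which lies in \<open>U\<close> by the quadrant extension property and satisfies
  \<open>(\<Sum>k. x k) \<bullet> p = (\<Sum>k. y k \<bullet> u k)\<close>, a contradiction.\<close>

section \<open>Orthogonalizing a family with nonnegative inner products\<close>

text \<open>The combinations with coefficients indexed by \<open>J\<close> form a subspace
  containing every \<open>x i\<close>. Indexing by \<open>J\<close> rather than by vectors allows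
  \<open>x\<close> to repeat vectors.\<close>

lemma in_span_image_imp_sum:
  assumes "finite J" and "a \<in> span (x ` J)"
  obtains c where "a = (\<Sum>j\<in>J. c j *\<^sub>R x j)"
proof -
  let ?S = "range (\<lambda>c. \<Sum>j\<in>J. c j *\<^sub>R x j)"
  have "subspace ?S"
  proof (rule subspaceI)
    show "0 \<in> ?S"
      by (rule range_eqI[of _ _ "\<lambda>_. 0"]) simp
  next
    fix a b assume "a \<in> ?S" "b \<in> ?S"
    then obtain c d where "a = (\<Sum>j\<in>J. c j *\<^sub>R x j)" "b = (\<Sum>j\<in>J. d j *\<^sub>R x j)"
      by blast
    then show "a + b \<in> ?S"
      by (intro range_eqI[of _ _ "\<lambda>j. c j + d j"]) (simp add: scaleR_left_distrib sum.distrib)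
  next
    fix r a assume "a \<in> ?S"
    then obtain c where "a = (\<Sum>j\<in>J. c j *\<^sub>R x j)"
      by blast
    then show "r *\<^sub>R a \<in> ?S"
      by (intro range_eqI[of _ _ "\<lambda>j. r * c j"]) (simp add: scaleR_sum_right)
  qed
  moreover have "x ` J \<subseteq> ?S"
  proof (rule image_subsetI)
    fix i assume "i \<in> J"
    have "x i = (\<Sum>j\<in>J. (if j = i then x i else 0))"
      using assms(1) \<open>i \<in> J\<close> by simp
    also have "\<dots> = (\<Sum>j\<in>J. (if j = i then 1 else 0) *\<^sub>R x j)"
      by (rule sum.cong) auto
    finally show "x i \<in> ?S"
      by (intro range_eqI)
  qed
  ultimately have "span (x ` J) \<subseteq> ?S"
    by (rule span_minimal[rotated])
  then show ?thesis
    using assms(2) that by blast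
qed

text \<open>The cardinality of this set plus that of \<open>nonorthogonal_pairs\<close> is the
  induction measure of the orthogonalization: each of its two moves strictly shrinks one set and
  does not enlarge the other.\<close>

definition nonzero_indices :: "'k set \<Rightarrow> ('k \<Rightarrow> 'a::real_inner) \<Rightarrow> 'k set" where
  "nonzero_indices I x = {i \<in> I. x i \<noteq> 0}"

definition nonorthogonal_pairs :: "'k set \<Rightarrow> ('k \<Rightarrow> 'a::real_inner) \<Rightarrow> ('k \<times> 'k) set" where
  "nonorthogonal_pairs I x = {(i, j) \<in> I \<times> I. i \<noteq> j \<and> x i \<bullet> x j \<noteq> 0}"

text \<open>Scaling \<open>x i\<close> by \<open>1 + t * c i\<close> with \<open>t > 0\<close> keeps
  the sum, since \<open>c\<close> is a linear dependence, and does not raise the objective, the sum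
  of the \<open>x i \<bullet> u i\<close>. At the largest \<open>t\<close> for which the factors of
  nonzero vectors stay nonnegative, one of these vectors vanishes.\<close>

lemma rescale_along_dependence:
  fixes x u :: "'k \<Rightarrow> 'a::euclidean_space"
  assumes fin: "finite I"
    and nonneg: "\<And>i j. i \<in> I \<Longrightarrow> j \<in> I \<Longrightarrow> i \<noteq> j \<Longrightarrow> x i \<bullet> x j \<ge> 0"
    and dep: "(\<Sum>i\<in>I. c i *\<^sub>R x i) = 0"
    and obj: "(\<Sum>i\<in>I. c i *\<^sub>R x i \<bullet> u i) \<le> 0"
    and neg: "k \<in> I" "c k < 0" "x k \<noteq> 0"
  obtains y where "(\<Sum>i\<in>I. y i) = (\<Sum>i\<in>I. x i)"
    and "(\<Sum>i\<in>I. y i \<bullet> u i) \<le> (\<Sum>i\<in>I. x i \<bullet> u i)"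
    and "\<And>i j. i \<in> I \<Longrightarrow> j \<in> I \<Longrightarrow> i \<noteq> j \<Longrightarrow> y i \<bullet> y j \<ge> 0"
    and "nonzero_indices I y \<subset> nonzero_indices I x"
    and "nonorthogonal_pairs I y \<subseteq> nonorthogonal_pairs I x"
proof -
  let ?N = "nonzero_indices I x"
  have finN: "finite ?N" and kN: "k \<in> ?N"
    using fin neg by (auto simp: nonzero_indices_def)
  \<comment> \<open>The minimum runs over nonzero vectors only, so the vector scaled to zero was
    nonzero before and \<open>nonzero_indices\<close> shrinks strictly.\<close>
  define c0 where "c0 = Min (c ` ?N)"
  have c0_le: "c0 \<le> c i" if "i \<in> I" "x i \<noteq> 0" for i
    using finN that by (simp add: c0_def nonzero_indices_def)
  have "c0 \<in> c ` ?N"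
    unfolding c0_def using finN kN by (intro Min_in) auto
  then obtain l where l: "l \<in> I" "x l \<noteq> 0" "c l = c0"
    by (auto simp: nonzero_indices_def)
  have c0: "c0 < 0"
    using c0_le[of k] neg by simp
  define t where "t = - 1 / c0"
  have t: "t > 0"
    using c0 by (simp add: t_def)
  define y where "y i = (1 + t * c i) *\<^sub>R x i" for i
  have coeff: "1 + t * c i \<ge> 0" if "i \<in> I" "x i \<noteq> 0" for i
    using c0_le[OF that] c0 by (simp add: t_def divide_simps)
  have yl: "y l = 0"
    using l c0 by (simp add: y_def t_def)
  show ?thesis
  proof (rule that[of y])
    have "(\<Sum>i\<in>I. y i) = (\<Sum>i\<in>I. x i) + t *\<^sub>R (\<Sum>i\<in>I. c i *\<^sub>R x i)"
      by (simp add: y_def scaleR_left_distrib sum.distrib scaleR_sum_right)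
    then show "(\<Sum>i\<in>I. y i) = (\<Sum>i\<in>I. x i)"
      using dep by simp
    have "(\<Sum>i\<in>I. y i \<bullet> u i) = (\<Sum>i\<in>I. x i \<bullet> u i) + t * (\<Sum>i\<in>I. c i *\<^sub>R x i \<bullet> u i)"
      by (simp add: y_def inner_add_left scaleR_left_distrib sum.distrib sum_distrib_left mult.assoc)
    then show "(\<Sum>i\<in>I. y i \<bullet> u i) \<le> (\<Sum>i\<in>I. x i \<bullet> u i)"
      using obj t by (simp add: mult_nonneg_nonpos)
    show "y i \<bullet> y j \<ge> 0" if "i \<in> I" "j \<in> I" "i \<noteq> j" for i j
    proof (cases "x i = 0 \<or> x j = 0")
      case True
      then show ?thesis by (auto simp: y_def)
    next
      case False
      then show ?thesis
        using coeff[of i] coeff[of j] nonneg[OF that] that by (simp add: y_def)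
    qed
    have "nonzero_indices I y \<subseteq> ?N"
      by (auto simp: nonzero_indices_def y_def)
    moreover have "l \<in> ?N" "l \<notin> nonzero_indices I y"
      using l yl by (auto simp: nonzero_indices_def)
    ultimately show "nonzero_indices I y \<subset> ?N"
      by blast
    show "nonorthogonal_pairs I y \<subseteq> nonorthogonal_pairs I x"
      by (auto simp: nonorthogonal_pairs_def y_def)
  qed
qed

text \<open>Adding \<open>t *\<^sub>R d\<close> to \<open>x a\<close> and subtracting it from
  \<open>x b\<close> keeps the sum; as \<open>d\<close> is orthogonal to the other vectors, inner
  products with them are unchanged. The inner product of the shifted pair is a quadratic in
  \<open>t\<close>, positive at 0 and with negative leading coefficient, so it has a root
  \<open>t \<ge> 0\<close>.\<close>

lemma shift_pair_to_orthogonal: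
  fixes x u :: "'k \<Rightarrow> 'a::euclidean_space"
  assumes fin: "finite I"
    and nonneg: "\<And>i j. i \<in> I \<Longrightarrow> j \<in> I \<Longrightarrow> i \<noteq> j \<Longrightarrow> x i \<bullet> x j \<ge> 0"
    and ab: "a \<in> I" "b \<in> I" "a \<noteq> b" "x a \<bullet> x b > 0"
    and d: "d \<noteq> 0" "\<And>l. l \<in> I - {a, b} \<Longrightarrow> d \<bullet> x l = 0"
    and obj: "d \<bullet> u a \<le> d \<bullet> u b"
  obtains y where "(\<Sum>i\<in>I. y i) = (\<Sum>i\<in>I. x i)"
    and "(\<Sum>i\<in>I. y i \<bullet> u i) \<le> (\<Sum>i\<in>I. x i \<bullet> u i)"
    and "\<And>i j. i \<in> I \<Longrightarrow> j \<in> I \<Longrightarrow> i \<noteq> j \<Longrightarrow> y i \<bullet> y j \<ge> 0"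
    and "nonzero_indices I y \<subseteq> nonzero_indices I x"
    and "nonorthogonal_pairs I y \<subset> nonorthogonal_pairs I x"
proof -
  define B where "B = d \<bullet> x b - d \<bullet> x a"
  define D where "D = d \<bullet> d"
  define G where "G = x a \<bullet> x b"
  have D: "D > 0" and G: "G > 0"
    using d(1) ab(4) by (simp_all add: D_def G_def)
  define r where "r = sqrt (B\<^sup>2 + 4 * G * D)"
  have r2: "r\<^sup>2 = B\<^sup>2 + 4 * G * D"
    using D G by (simp add: r_def)
  have "\<bar>B\<bar> \<le> r"
    unfolding r_def using D G by (intro real_le_rsqrt) simp
  \<comment> \<open>The larger root of \<open>G + t * B - t\<^sup>2 * D\<close>, the inner product
    of the shifted pair.\<close>
  define t where "t = (B + r) / (2 * D)"
  have t: "t \<ge> 0"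
    using \<open>\<bar>B\<bar> \<le> r\<close> D by (simp add: t_def)
  have root: "G + t * B - t\<^sup>2 * D = 0"
  proof -
    have "2 * D * t = B + r"
      using D by (simp add: t_def)
    then have "(2 * D * t - B)\<^sup>2 = B\<^sup>2 + 4 * G * D"
      using r2 by simp
    then have "4 * D * (G + t * B - t\<^sup>2 * D) = 0"
      by (simp add: power2_eq_square algebra_simps)
    then show ?thesis
      using D by simp
  qed
  define e where "e i = (if i = a then d else if i = b then - d else 0)" for i
  define y where "y i = x i + t *\<^sub>R e i" for i
  \<comment> \<open>\<open>F\<close> is left general to serve both the sum of the shifts and their
    effect on the objective.\<close>
  have e_sum: "(\<Sum>i\<in>I. F i (e i)) = F a d + F b (- d)" if "\<And>i. F i 0 = 0"
    for F :: "'k \<Rightarrow> 'a \<Rightarrow> 'b::comm_monoid_add"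
  proof -
    have "(\<Sum>i\<in>I. F i (e i)) = (\<Sum>i\<in>{a, b}. F i (e i))"
      using fin ab that by (intro sum.mono_neutral_right) (auto simp: e_def)
    then show ?thesis
      using ab by (simp add: e_def)
  qed
  have yab: "y a \<bullet> y b = 0"
    using root ab(3)
    by (simp add: y_def e_def B_def D_def G_def inner_diff_right inner_add_left inner_commute
        power2_eq_square algebra_simps)
  then have yba: "y b \<bullet> y a = 0"
    by (simp add: inner_commute)
  \<comment> \<open>Here at most one of the two indices is shifted, and then its partner is
    orthogonal to \<open>d\<close>.\<close>
  have other: "y i \<bullet> y j = x i \<bullet> x j" if "i \<in> I" "j \<in> I" "i \<noteq> j" "{i, j} \<noteq> {a, b}" for i j
  proof -
    have "e i = 0 \<or> e j = 0" "i \<in> {a, b} \<Longrightarrow> d \<bullet> x j = 0" "j \<in> {a, b} \<Longrightarrow> x i \<bullet> d = 0"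
      using that d(2)[of i] d(2)[of j] by (auto simp: e_def inner_commute)
    then show ?thesis
      by (auto simp: y_def e_def inner_add_left inner_add_right inner_diff_right inner_diff_left split: if_splits)
  qed
  have pair: "y i \<bullet> y j = 0" if "{i, j} = {a, b}" "i \<noteq> j" for i j
    using that yab yba by (auto simp: doubleton_eq_iff)
  show ?thesis
  proof (rule that[of y])
    have "(\<Sum>i\<in>I. y i) = (\<Sum>i\<in>I. x i) + t *\<^sub>R (\<Sum>i\<in>I. e i)"
      by (simp add: y_def sum.distrib scaleR_sum_right)
    then show "(\<Sum>i\<in>I. y i) = (\<Sum>i\<in>I. x i)"
      using e_sum[of "\<lambda>_ z. z"] by simp
    have "(\<Sum>i\<in>I. y i \<bullet> u i) = (\<Sum>i\<in>I. x i \<bullet> u i) + t * (\<Sum>i\<in>I. e i \<bullet> u i)"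
      by (simp add: y_def inner_add_left sum.distrib sum_distrib_left)
    then show "(\<Sum>i\<in>I. y i \<bullet> u i) \<le> (\<Sum>i\<in>I. x i \<bullet> u i)"
      using e_sum[of "\<lambda>i z. z \<bullet> u i"] obj t by (simp add: mult_nonneg_nonpos)
    show "y i \<bullet> y j \<ge> 0" if "i \<in> I" "j \<in> I" "i \<noteq> j" for i j
      using other[OF that] pair[of i j] nonneg[OF that] that by (cases "{i, j} = {a, b}") auto
    \<comment> \<open>Only \<open>x a\<close> and \<open>x b\<close> move, and both are already
      counted as nonzero.\<close>
    have "x a \<noteq> 0" "x b \<noteq> 0"
      using ab(4) by auto
    then show "nonzero_indices I y \<subseteq> nonzero_indices I x"
      by (auto simp: nonzero_indices_def y_def e_def split: if_splits)
    have "nonorthogonal_pairs I y \<subseteq> nonorthogonal_pairs I x"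
    proof
      fix z assume "z \<in> nonorthogonal_pairs I y"
      then obtain i j where z: "z = (i, j)" "i \<in> I" "j \<in> I" "i \<noteq> j" "y i \<bullet> y j \<noteq> 0"
        by (auto simp: nonorthogonal_pairs_def)
      then have "{i, j} \<noteq> {a, b}"
        using pair by blast
      then show "z \<in> nonorthogonal_pairs I x"
        using other[of i j] z by (simp add: nonorthogonal_pairs_def)
    qed
    moreover have "(a, b) \<in> nonorthogonal_pairs I x" "(a, b) \<notin> nonorthogonal_pairs I y"
      using ab yab by (auto simp: nonorthogonal_pairs_def)
    ultimately show "nonorthogonal_pairs I y \<subset> nonorthogonal_pairs I x"
      by blast
  qed
qed

text \<open>Moving \<open>x a\<close> and \<open>x b\<close> in opposite directions orthogonal to all other vectors makes the two
  orthogonal without affecting the remaining inner products. If there is no such direction, the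
  other vectors span the space, and rescaling along a linear dependence makes some vector vanish.\<close>

lemma orthogonalize_nonneg_family:
  fixes x u :: "'k \<Rightarrow> 'a::euclidean_space"
  assumes fin: "finite I"
    and "\<And>i j. i \<in> I \<Longrightarrow> j \<in> I \<Longrightarrow> i \<noteq> j \<Longrightarrow> x i \<bullet> x j \<ge> 0"
  shows "\<exists>y. (\<Sum>i\<in>I. y i) = (\<Sum>i\<in>I. x i) \<and> (\<Sum>i\<in>I. y i \<bullet> u i) \<le> (\<Sum>i\<in>I. x i \<bullet> u i)
    \<and> (\<forall>i\<in>I. \<forall>j\<in>I. i \<noteq> j \<longrightarrow> y i \<bullet> y j = 0)"
  using assms(2)
proof (induction "card (nonzero_indices I x) + card (nonorthogonal_pairs I x)" arbitrary: x
    rule: less_induct)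
  case less
  note nonneg = less.prems
  have finN: "finite (nonzero_indices I z)" and finP: "finite (nonorthogonal_pairs I z)"
    for z :: "'k \<Rightarrow> 'a"
    using fin finite_subset[of "nonorthogonal_pairs I z" "I \<times> I"]
    by (auto simp: nonzero_indices_def nonorthogonal_pairs_def)
  \<comment> \<open>It suffices to reach any admissible family of smaller measure: orthogonalizing
    that one keeps the sum and lowers the objective further or leaves it.\<close>
  have step: ?case
    if s: "(\<Sum>i\<in>I. y i) = (\<Sum>i\<in>I. x i)" "(\<Sum>i\<in>I. y i \<bullet> u i) \<le> (\<Sum>i\<in>I. x i \<bullet> u i)"
      "\<And>i j. i \<in> I \<Longrightarrow> j \<in> I \<Longrightarrow> i \<noteq> j \<Longrightarrow> y i \<bullet> y j \<ge> 0"
      "card (nonzero_indices I y) + card (nonorthogonal_pairs I y)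
        < card (nonzero_indices I x) + card (nonorthogonal_pairs I x)" for y
    proof -
    obtain y' where "(\<Sum>i\<in>I. y' i) = (\<Sum>i\<in>I. y i)" "(\<Sum>i\<in>I. y' i \<bullet> u i) \<le> (\<Sum>i\<in>I. y i \<bullet> u i)"
      "\<forall>i\<in>I. \<forall>j\<in>I. i \<noteq> j \<longrightarrow> y' i \<bullet> y' j = 0"
      using less.hyps[OF s(4) s(3)] by blast
    then show ?thesis
      using s(1,2) by (intro exI[of _ y']) simp
  qed
  show ?case
  proof (cases "\<forall>i\<in>I. \<forall>j\<in>I. i \<noteq> j \<longrightarrow> x i \<bullet> x j = 0")
    case True
    then show ?thesis by blast
  next
    case False
    then obtain a b where ab: "a \<in> I" "b \<in> I" "a \<noteq> b" "x a \<bullet> x b > 0"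
      using nonneg by (metis order_le_less)
    let ?J = "I - {a, b}"
    show ?thesis
    proof (cases "dim (x ` ?J) < DIM('a)")
      case True
      then obtain d0 where d0: "d0 \<noteq> 0" "\<And>z. z \<in> span (x ` ?J) \<Longrightarrow> orthogonal d0 z"
        by (rule orthogonal_to_subspace_exists) blast
      \<comment> \<open>The sign of the direction is free; it is chosen so that the objective does
        not increase.\<close>
      define d where "d = (if d0 \<bullet> u a \<le> d0 \<bullet> u b then d0 else - d0)"
      have d: "d \<noteq> 0" "d \<bullet> u a \<le> d \<bullet> u b"
        using d0(1) by (auto simp: d_def)
      have "d \<bullet> x l = 0" if "l \<in> ?J" for l
        using d0(2)[of "x l"] that by (auto simp: d_def orthogonal_def span_base)
      from shift_pair_to_orthogonal[OF fin nonneg ab d(1) this d(2)] obtain y where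
        y: "(\<Sum>i\<in>I. y i) = (\<Sum>i\<in>I. x i)" "(\<Sum>i\<in>I. y i \<bullet> u i) \<le> (\<Sum>i\<in>I. x i \<bullet> u i)"
          "\<And>i j. i \<in> I \<Longrightarrow> j \<in> I \<Longrightarrow> i \<noteq> j \<Longrightarrow> y i \<bullet> y j \<ge> 0"
          "nonzero_indices I y \<subseteq> nonzero_indices I x"
          "nonorthogonal_pairs I y \<subset> nonorthogonal_pairs I x"
        by blast
      have "card (nonzero_indices I y) + card (nonorthogonal_pairs I y)
          < card (nonzero_indices I x) + card (nonorthogonal_pairs I x)"
        using card_mono[OF finN y(4)] psubset_card_mono[OF finP y(5)] by linarith
      with y(1-3) show ?thesis
        by (rule step)
    next
      case False
      then have "span (x ` ?J) = UNIV"
        using dim_subset_UNIV[of "x ` ?J"] by (simp flip: dim_eq_full)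
      then obtain c where c: "x a = (\<Sum>j\<in>?J. c j *\<^sub>R x j)"
        using in_span_image_imp_sum[of ?J "x a" x] fin by auto
      \<comment> \<open>Otherwise, pairing the expansion of \<open>x a\<close> with
        \<open>x b\<close> would give a nonpositive value.\<close>
      have "\<exists>l\<in>?J. c l > 0 \<and> x l \<noteq> 0"
      proof (rule ccontr)
        assume *: "\<not> ?thesis"
        have "x a \<bullet> x b = (\<Sum>j\<in>?J. c j * (x j \<bullet> x b))"
          by (simp add: c inner_sum_left)
        also have "\<dots> \<le> 0"
        proof (rule sum_nonpos)
          fix j assume "j \<in> ?J"
          with * have "c j \<le> 0 \<or> x j = 0"
            by (meson not_le)
          then show "c j * (x j \<bullet> x b) \<le> 0"
            using nonneg[of j b] \<open>j \<in> ?J\<close> ab by (auto intro: mult_nonpos_nonneg)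
        qed
        finally show False
          using ab by simp
      qed
      then obtain l where l: "l \<in> ?J" "c l > 0" "x l \<noteq> 0"
        by blast
      define c' where "c' j = (if j = a then - 1 else if j = b then 0 else c j)" for j
      have dep: "(\<Sum>j\<in>I. c' j *\<^sub>R x j) = 0"
      proof -
        have "(\<Sum>j\<in>I. c' j *\<^sub>R x j) = c' a *\<^sub>R x a + (c' b *\<^sub>R x b + (\<Sum>j\<in>?J. c' j *\<^sub>R x j))"
          using ab fin
          by (simp add: sum.remove[of I a] sum.remove[of "I - {a}" b] Diff_insert2[of I a "{b}"])
        also have "(\<Sum>j\<in>?J. c' j *\<^sub>R x j) = (\<Sum>j\<in>?J. c j *\<^sub>R x j)"
          by (rule sum.cong) (auto simp: c'_def)
        finally show ?thesis
          using c ab by (simp add: c'_def)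
      qed
      \<comment> \<open>The dependence has coefficient -1 at the nonzero \<open>x a\<close> and a
        positive one at the nonzero \<open>x l\<close>. So either sign \<open>s\<close> leaves a
        negative coefficient, and \<open>s\<close> can be chosen by the objective.\<close>
      have "\<exists>s k. (\<Sum>i\<in>I. (s * c' i) *\<^sub>R x i \<bullet> u i) \<le> 0 \<and> k \<in> I \<and> s * c' k < 0 \<and> x k \<noteq> 0"
      proof (cases "(\<Sum>i\<in>I. c' i *\<^sub>R x i \<bullet> u i) \<le> 0")
        case True
        then show ?thesis
          using ab by (intro exI[of _ 1] exI[of _ a]) (auto simp: c'_def)
      next
        case False
        then show ?thesis
          using l by (intro exI[of _ "- 1"] exI[of _ l]) (auto simp: c'_def sum_negf)
      qed
      then obtain s k where sk: "(\<Sum>i\<in>I. (s * c' i) *\<^sub>R x i \<bullet> u i) \<le> 0"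
          "k \<in> I" "s * c' k < 0" "x k \<noteq> 0"
        by blast
      have "(\<Sum>i\<in>I. (s * c' i) *\<^sub>R x i) = 0"
        using dep by (simp flip: scaleR_scaleR scaleR_sum_right)
      from rescale_along_dependence[OF fin nonneg this sk] obtain y where
        y: "(\<Sum>i\<in>I. y i) = (\<Sum>i\<in>I. x i)" "(\<Sum>i\<in>I. y i \<bullet> u i) \<le> (\<Sum>i\<in>I. x i \<bullet> u i)"
          "\<And>i j. i \<in> I \<Longrightarrow> j \<in> I \<Longrightarrow> i \<noteq> j \<Longrightarrow> y i \<bullet> y j \<ge> 0"
          "nonzero_indices I y \<subset> nonzero_indices I x"
          "nonorthogonal_pairs I y \<subseteq> nonorthogonal_pairs I x"
        by blast
      have "card (nonzero_indices I y) + card (nonorthogonal_pairs I y)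
          < card (nonzero_indices I x) + card (nonorthogonal_pairs I x)"
        using psubset_card_mono[OF finN y(4)] card_mono[OF finP y(5)] by linarith
      with y(1-3) show ?thesis
        by (rule step)
    qed
  qed
qed

section \<open>A theorem of the alternative for half-spaces\<close>

text \<open>First-order optimality at the least infeasible point \<open>z\<close> of
  \<open>U\<close> says that the weighted sum of the \<open>w k\<close> attains its minimum over
  \<open>U\<close> at \<open>z\<close>, and there the weighted constraint is already violated by the
  sum of the \<open>(l k)\<^sup>2\<close>.\<close>

lemma halfspaces_alternative:
  fixes U :: "'a::euclidean_space set"
  assumes "compact U" "convex U" "U \<noteq> {}" and fin: "finite I"
    and infeasible: "\<And>p. p \<in> U \<Longrightarrow> \<exists>k\<in>I. w k \<bullet> p > b k"
  obtains l :: "'k \<Rightarrow> real" where "\<And>k. k \<in> I \<Longrightarrow> l k \<ge> 0"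
    and "\<And>p. p \<in> U \<Longrightarrow> (\<Sum>k\<in>I. l k * b k) < (\<Sum>k\<in>I. l k * (w k \<bullet> p))"
proof -
  text \<open>The weights are the constraint violations at a minimizer \<open>z\<close> of their sum of squares.\<close>
  define Phi where "Phi p = (\<Sum>k\<in>I. (max 0 (w k \<bullet> p - b k))\<^sup>2)" for p
  have "continuous_on U Phi"
    unfolding Phi_def by (intro continuous_intros)
  then obtain z where z: "z \<in> U" "\<And>p. p \<in> U \<Longrightarrow> Phi z \<le> Phi p"
    using continuous_attains_inf[OF assms(1,3)] by metis
  define l where "l k = max 0 (w k \<bullet> z - b k)" for k
  have lz: "l k * (w k \<bullet> z) = (l k)\<^sup>2 + l k * b k" for k
    by (auto simp: l_def max_def power2_eq_square algebra_simps)
  have pos: "(\<Sum>k\<in>I. (l k)\<^sup>2) > 0"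
  proof -
    obtain k where "k \<in> I" "w k \<bullet> z > b k"
      using infeasible z(1) by blast
    then show ?thesis
      using fin by (intro sum_pos2[of I k]) (auto simp: l_def)
  qed
  have first_order: "(\<Sum>k\<in>I. l k * (w k \<bullet> (p - z))) \<ge> 0" if p: "p \<in> U" for p
  proof (rule ccontr)
    define A where "A = (\<Sum>k\<in>I. l k * (w k \<bullet> (p - z)))"
    define C where "C = (\<Sum>k\<in>I. (w k \<bullet> (p - z))\<^sup>2)"
    assume "\<not> ?thesis"
    then have A: "A < 0"
      by (simp add: A_def)
    have C: "C \<ge> 0"
      by (simp add: C_def sum_nonneg)
    \<comment> \<open>Minimality of \<open>z\<close> along the segment towards \<open>p\<close>; a
      negative linear coefficient is then refuted by a small \<open>t\<close>.\<close>
    have quad: "0 \<le> 2 * t * A + t\<^sup>2 * C" if t: "0 \<le> t" "t \<le> 1" for t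
    proof -
      have "z + t *\<^sub>R (p - z) \<in> U"
        using convexD_alt[OF assms(2) z(1) p t] by (simp add: algebra_simps)
      then have "Phi z \<le> Phi (z + t *\<^sub>R (p - z))"
        by (rule z(2))
      also have "\<dots> \<le> (\<Sum>k\<in>I. (l k + t * (w k \<bullet> (p - z)))\<^sup>2)"
        unfolding Phi_def
      proof (rule sum_mono)
        fix k assume "k \<in> I"
        \<comment> \<open>A nonzero left side is the signed violation at the new point; replacing
          the signed violation at \<open>z\<close> in it by its positive part \<open>l k\<close> can
          only enlarge it.\<close>
        have "\<bar>max 0 (w k \<bullet> (z + t *\<^sub>R (p - z)) - b k)\<bar> \<le> \<bar>l k + t * (w k \<bullet> (p - z))\<bar>"
          unfolding l_def inner_add_right inner_scaleR_right by linarith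
        then show "(max 0 (w k \<bullet> (z + t *\<^sub>R (p - z)) - b k))\<^sup>2 \<le> (l k + t * (w k \<bullet> (p - z)))\<^sup>2"
          by (simp only: abs_le_square_iff)
      qed
      also have "\<dots> = Phi z + (2 * t * A + t\<^sup>2 * C)"
        by (simp add: Phi_def A_def C_def power2_sum sum.distrib sum_distrib_left
            power_mult_distrib mult.commute mult.left_commute mult.assoc flip: l_def)
      finally show ?thesis
        by simp
    qed
    \<comment> \<open>Small enough for \<open>t * C \<le> - A\<close>, so that the linear term
      dominates; \<open>C + 1\<close> avoids dividing by zero.\<close>
    define t where "t = min 1 (- A / (C + 1))"
    have t: "0 < t" "t \<le> 1"
      using A C by (auto simp: t_def divide_neg_pos)
    have "t * C \<le> - A"
    proof -
      have "t * C \<le> (- A / (C + 1)) * (C + 1)"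
        using t C A by (intro mult_mono) (auto simp: t_def divide_nonpos_pos)
      then show ?thesis
        using C by simp
    qed
    then have "2 * A + t * C < 0"
      using A by simp
    then have "t * (2 * A + t * C) < 0"
      using t by (simp add: mult_pos_neg)
    then show False
      using quad[of t] t by (simp add: power2_eq_square algebra_simps)
  qed
  show ?thesis
  proof (rule that[of l])
    show "l k \<ge> 0" for k
      by (simp add: l_def)
    fix p assume "p \<in> U"
    have "(\<Sum>k\<in>I. l k * b k) < (\<Sum>k\<in>I. l k * (w k \<bullet> z))"
      using pos by (simp add: lz sum.distrib)
    also have "\<dots> \<le> (\<Sum>k\<in>I. l k * (w k \<bullet> p))"
      using first_order[OF \<open>p \<in> U\<close>] by (simp add: inner_diff_right right_diff_distrib sum_subtractf)
    finally show "(\<Sum>k\<in>I. l k * b k) < (\<Sum>k\<in>I. l k * (w k \<bullet> p))" .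
  qed
qed

section \<open>Common points from the quadrant extension property\<close>

text \<open>The nonzero \<open>y k\<close> extend to an orthogonal basis of the space, which
  supplies the normals of exactly as many hyperplanes as the property asks for. The one normal to
  \<open>y k\<close> passes through \<open>u k\<close>; for \<open>y k = 0\<close> the equation is
  trivial.\<close>

lemma quadrant_extension_orthogonal_family:
  fixes y u :: "'k \<Rightarrow> real ^ 'm"
  assumes qep: "quadrant_extension_property U' U"
    and "I \<noteq> {}"
    and u: "\<And>k. k \<in> I \<Longrightarrow> u k \<in> U'"
    and orth: "\<And>i j. i \<in> I \<Longrightarrow> j \<in> I \<Longrightarrow> i \<noteq> j \<Longrightarrow> y i \<bullet> y j = 0"
  obtains p where "p \<in> U" and "\<And>k. k \<in> I \<Longrightarrow> y k \<bullet> p = y k \<bullet> u k"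
proof -
  obtain k0 where k0: "k0 \<in> I"
    using assms(2) by blast
  define J where "J = {k \<in> I. y k \<noteq> 0}"
  have inj: "inj_on y J"
    using orth by (intro inj_onI) (metis (mono_tags, lifting) J_def inner_eq_zero_iff mem_Collect_eq)
  have "pairwise orthogonal (y ` J)"
    using orth by (auto simp: pairwise_def orthogonal_def J_def)
  then obtain T where T: "T \<inter> insert 0 (y ` J) = {}" "pairwise orthogonal (y ` J \<union> T)"
      "span (y ` J \<union> T) = span (y ` J \<union> UNIV)"
    by (rule orthogonal_extension_strong)
  define B where "B = y ` J \<union> T"
  have nz: "0 \<notin> B"
    using T(1) by (auto simp: B_def J_def)
  have "independent B"
    using T(2) nz by (intro pairwise_orthogonal_independent) (simp_all add: B_def)
  moreover have "span B = UNIV"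
    using T(3) by (simp add: B_def)
  ultimately have "card B = CARD('m)" "finite B"
    using dim_eq_card[of B UNIV] independent_bound[of B] by (simp_all add: dim_UNIV)
  then obtain a where a: "bij_betw a (UNIV :: 'm set) B"
    using finite_same_card_bij[of "UNIV :: 'm set" B] by auto
  \<comment> \<open>Nonzero orthogonal vectors are distinct, so each \<open>y k\<close> determines
    its \<open>k\<close>. The added basis vectors need just some point of \<open>U'\<close>, for
    which \<open>u k0\<close> serves.\<close>
  define g where "g v = (if v \<in> y ` J then u (inv_into J y v) else u k0)" for v
  define P where "P i = {x. a i \<bullet> x = a i \<bullet> g (a i)}" for i
  have aB: "a i \<in> B" for i
    using a by (auto simp: bij_betw_def)
  have g: "g v \<in> U'" for v
  proof (cases "v \<in> y ` J")
    case True
    then have "inv_into J y v \<in> J"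
      by (rule inv_into_into)
    then show ?thesis
      using True u by (simp add: g_def J_def)
  qed (use u k0 in \<open>simp add: g_def\<close>)
  have a_orth: "orthogonal (a i) (a j)" if "i \<noteq> j" for i j
    using T(2) aB[of i] aB[of j] a that
    by (auto simp: B_def[symmetric] pairwise_def bij_betw_def inj_def)
  have "a i \<noteq> 0" for i
    using aB[of i] nz by metis
  then have hyp: "orthogonal_hyperplanes P"
    unfolding orthogonal_hyperplanes_def
    by (intro exI[of _ a] exI[of _ "\<lambda>i. a i \<bullet> g (a i)"] conjI allI impI a_orth)
      (simp_all add: P_def)
  define p where "p = (THE p. \<forall>i. p \<in> P i)"
  have "P i \<inter> U' \<noteq> {}" for i
    using g[of "a i"] by (auto simp: P_def)
  then have "p \<in> U"
    using qep hyp by (simp add: quadrant_extension_property_def p_def)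
  moreover have "\<forall>i. p \<in> P i"
    unfolding p_def by (rule theI') (rule orthogonal_hyperplanes_common_point[OF hyp])
  moreover have "y k \<bullet> p = y k \<bullet> u k" if "k \<in> I" "\<forall>i. p \<in> P i" for k
  proof (cases "y k = 0")
    case False
    then have kJ: "k \<in> J"
      using that by (simp add: J_def)
    then have "y k \<in> B"
      by (simp add: B_def)
    then obtain i where i: "a i = y k"
      using a by (metis bij_betw_imp_surj_on imageE)
    have "g (y k) = u k"
      using kJ inj by (simp add: g_def)
    then show ?thesis
      using that(2) i by (metis (mono_tags, lifting) P_def mem_Collect_eq)
  qed simp
  ultimately show ?thesis
    using that by blast
qed

lemma quadrant_extension_halfspaces:
  fixes w :: "'k \<Rightarrow> real ^ 'm"
  assumes "compact U" "convex U" "U \<noteq> {}" and fin: "finite I"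
    and qep: "quadrant_extension_property U' U"
    and feasible: "\<And>k. k \<in> I \<Longrightarrow> \<exists>u\<in>U'. w k \<bullet> u \<le> b k"
    and nonneg: "\<And>i j. i \<in> I \<Longrightarrow> j \<in> I \<Longrightarrow> w i \<bullet> w j \<ge> 0"
  shows "\<exists>p\<in>U. \<forall>k\<in>I. w k \<bullet> p \<le> b k"
proof (rule ccontr)
  assume "\<not> ?thesis"
  then have infeasible: "\<exists>k\<in>I. w k \<bullet> p > b k" if "p \<in> U" for p
    using that by (meson not_le)
  \<comment> \<open>With no constraints, any point of \<open>U\<close> would be feasible.\<close>
  then have "I \<noteq> {}"
    using assms(3) by blast
  obtain l where l: "\<And>k. k \<in> I \<Longrightarrow> l k \<ge> 0"
      "\<And>p. p \<in> U \<Longrightarrow> (\<Sum>k\<in>I. l k * b k) < (\<Sum>k\<in>I. l k * (w k \<bullet> p))"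
    using halfspaces_alternative[OF assms(1-3) fin infeasible] by blast
  obtain u where u: "\<And>k. k \<in> I \<Longrightarrow> u k \<in> U'" "\<And>k. k \<in> I \<Longrightarrow> w k \<bullet> u k \<le> b k"
    using feasible by metis
  have "l i *\<^sub>R w i \<bullet> l j *\<^sub>R w j \<ge> 0" if "i \<in> I" "j \<in> I" for i j
    using l(1) nonneg that by simp
  then obtain y where y: "(\<Sum>k\<in>I. y k) = (\<Sum>k\<in>I. l k *\<^sub>R w k)"
      "(\<Sum>k\<in>I. y k \<bullet> u k) \<le> (\<Sum>k\<in>I. l k *\<^sub>R w k \<bullet> u k)"
      "\<forall>i\<in>I. \<forall>j\<in>I. i \<noteq> j \<longrightarrow> y i \<bullet> y j = 0"
    using orthogonalize_nonneg_family[OF fin, of "\<lambda>k. l k *\<^sub>R w k" u] by blast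
  obtain p where p: "p \<in> U" "\<And>k. k \<in> I \<Longrightarrow> y k \<bullet> p = y k \<bullet> u k"
    using quadrant_extension_orthogonal_family[where y = y and u = u, OF qep \<open>I \<noteq> {}\<close> u(1)] y(3) by metis
  have "(\<Sum>k\<in>I. l k * (w k \<bullet> p)) = (\<Sum>k\<in>I. l k *\<^sub>R w k) \<bullet> p"
    by (simp add: inner_sum_left)
  also have "\<dots> = (\<Sum>k\<in>I. y k \<bullet> p)"
    by (simp flip: y(1) add: inner_sum_left)
  also have "\<dots> = (\<Sum>k\<in>I. y k \<bullet> u k)"
    using p(2) by simp
  \<comment> \<open>Orthogonalization did not raise the objective, and each \<open>u k\<close>
    satisfies its own constraint, weighted by \<open>l k \<ge> 0\<close>.\<close>
  also have "\<dots> \<le> (\<Sum>k\<in>I. l k * b k)"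
    using y(2) sum_mono[of I "\<lambda>k. l k * (w k \<bullet> u k)" "\<lambda>k. l k * b k"] l(1) u(2)
    by (simp add: mult_left_mono)
  finally show False
    using l(2)[OF p(1)] by simp
qed

section \<open>Barrier conditions as half-spaces at a fixed state\<close>

theorem theorem2:
  fixes f :: "(real ^ 'n1) \<times> (real ^ 'n2) \<Rightarrow> real ^ 'n2"
    and g1 :: "real ^ 'n1 \<Rightarrow> real ^ 'n2 ^ 'n1"
    and g2 :: "real ^ 'n1 \<Rightarrow> real ^ 'm ^ 'n2"
    and U U' :: "(real ^ 'm) set"
    and N1 N2 M :: nat
    and \<kappa> :: "nat \<Rightarrow> real ^ 'n1 \<Rightarrow> real"
    and \<eta> :: "nat \<Rightarrow> real ^ 'n2 \<Rightarrow> real"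
    and h :: "nat \<Rightarrow> (real ^ 'n1) \<times> (real ^ 'n2) \<Rightarrow> real"
    and \<alpha> :: "nat \<Rightarrow> real \<Rightarrow> real"
    and S :: "((real ^ 'n1) \<times> (real ^ 'n2)) set"
  assumes "C2 f" and "C2 g1" and "C2 g2"
    and "compact U" and "convex U" and "0 \<in> U"
    and "\<And>i. i \<in> {1..N1} \<Longrightarrow> C2 (\<kappa> i)"
    and "\<And>j. j \<in> {1..N2} \<Longrightarrow> C1 (\<eta> j)"
    and "S = safe_set N1 \<kappa> N2 \<eta>"
    and "U' \<subseteq> U"
    and "quadrant_extension_property U' U"
    and "\<And>k. k \<in> {1..M} \<Longrightarrow> control_barrier_function f g1 g2 S U' (h k)"
    and "\<And>k. k \<in> {1..M} \<Longrightarrow> cbf_witness f g1 g2 S U' (h k) (\<alpha> k)"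
    and "non_interfering g2 S M h"
  shows "\<forall>q v. (q, v) \<in> S \<inter> (\<Inter>k\<in>{1..M}. sublevel (h k)) \<longrightarrow>
           (\<Inter>k\<in>{1..M}. mu f g1 g2 (h k) (\<alpha> k) q v U) \<noteq> {}"
proof (intro allI impI)
  fix q v
  assume qv: "(q, v) \<in> S \<inter> (\<Inter>k\<in>{1..M}. sublevel (h k))"
  \<comment> \<open>\<open>hdot\<close> is affine in the control: \<open>w k\<close> is its linear
    part, and all terms free of \<open>u\<close> go into \<open>b k\<close>. Non-interference
    becomes \<open>w i \<bullet> w j \<ge> 0\<close>.\<close>
  define w where "w k = grad_v (h k) q v v* g2 q" for k
  define b where "b k = \<alpha> k (- h k (q, v)) - grad_q (h k) q v \<bullet> (g1 q *v v)
    - grad_v (h k) q v \<bullet> f (q, v)" for k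
  have mu: "u \<in> mu f g1 g2 (h k) (\<alpha> k) q v Y \<longleftrightarrow> u \<in> Y \<and> w k \<bullet> u \<le> b k" for k u Y
    by (auto simp: mu_def hdot_def w_def b_def dot_lmul_matrix inner_add_right)
  have "\<exists>p\<in>U. \<forall>k\<in>{1..M}. w k \<bullet> p \<le> b k"
  proof (rule quadrant_extension_halfspaces[OF assms(4,5) _ _ assms(11)])
    show "U \<noteq> {}"
      using assms(6) by blast
    show "\<exists>u\<in>U'. w k \<bullet> u \<le> b k" if "k \<in> {1..M}" for k
    proof -
      have "mu f g1 g2 (h k) (\<alpha> k) q v U' \<noteq> {}"
        using assms(13)[OF that] qv that by (auto simp: cbf_witness_def)
      then show ?thesis
        using mu by blast
    qed
    show "w i \<bullet> w j \<ge> 0" if "i \<in> {1..M}" "j \<in> {1..M}" for i j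
      using assms(14) qv that unfolding non_interfering_def w_def by blast
  qed simp
  then show "(\<Inter>k\<in>{1..M}. mu f g1 g2 (h k) (\<alpha> k) q v U) \<noteq> {}"
    using mu by blast
qed

end
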